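(* Let $\mathscr C$ be a closed function clone with domain $C$ which contains all constant functions on $C$, and let $\xi\colon\mathscr C\to\mathscr D$ be a clone isomorphism onto a function clone $\mathscr D$. Then the image of any open subset of $\mathscr C$ under $\xi$ is open in $\mathscr D$.
   Context: For a set $D$, $\mathscr O_D$ denotes the set of all operations $D^n\to D$, $n\ge1$. A function clone with domain $D$ is a subset of $\mathscr O_D$ containing all projections $\pi^n_k(x_1,\dots,x_n)=x_k$ and closed under composition $f(g_1,\dots,g_n)$ ($f$ $n$-ary, all $g_i$ $m$-ary). $\mathscr O_D$ carries the topology of pointwise convergence: for each $n$ the set of $n$-ary operations is clopen, and a subbasis is given by the sets $\{f\colon D^n\to D \mid f(a_1,\dots,a_n)=a_0\}$; function clones carry the subspace topology, and a function clone is closed if it is closed in $\mathscr O_D$. A clone homomorphism between function clones (possibly on different domains) is a map preserving arities, sending each projection $\pi^n_k$ to the corresponding projection $\pi^n_k$, and satisfying $\xi(f(g_1,\dots,g_n))=\xi(f)(\xi(g_1),\dots,\xi(g_n))$; an isomorphism is a bijective homomorphism. *)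

theory Defs
  imports "HOL-Analysis.Abstract_Topology" "HOL-Library.FuncSet"
begin

text \<open>
  A tuple in \<open>D\<close> to the power \<open>n\<close> is an extensional function on \<open>{..<n}\<close>, so indices
  start at 0. An operation is a pair of its arity and an extensional function on such tuples. The
  arity is carried explicitly because over the empty domain operations of different arities have
  the same graph.
\<close>

type_synonym 'a oper = "nat \<times> ((nat \<Rightarrow> 'a) \<Rightarrow> 'a)"

abbreviation arity :: "'a oper \<Rightarrow> nat" where
  "arity \<equiv> fst"

abbreviation app :: "'a oper \<Rightarrow> (nat \<Rightarrow> 'a) \<Rightarrow> 'a" where
  "app \<equiv> snd"

definition tuples :: "'a set \<Rightarrow> nat \<Rightarrow> (nat \<Rightarrow> 'a) set" where
  "tuples D n = ({..<n} \<rightarrow>\<^sub>E D)"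

definition nary_operations :: "'a set \<Rightarrow> nat \<Rightarrow> 'a oper set" where
  "nary_operations D n = {f. arity f = n \<and> app f \<in> tuples D n \<rightarrow>\<^sub>E D}"

definition operations :: "'a set \<Rightarrow> 'a oper set" where
  "operations D = (\<Union>n\<in>{1..}. nary_operations D n)"

definition projection :: "'a set \<Rightarrow> nat \<Rightarrow> nat \<Rightarrow> 'a oper" where
  "projection D n k = (n, \<lambda>x\<in>tuples D n. x k)"

definition constant_oper :: "'a set \<Rightarrow> nat \<Rightarrow> 'a \<Rightarrow> 'a oper" where
  "constant_oper D n c = (n, \<lambda>x\<in>tuples D n. c)"

text \<open>
  The composition of \<open>f\<close> with the \<open>m\<close>-ary operations \<open>g i\<close> for \<open>i < arity f\<close>; the values
  of \<open>g\<close> at other indices are irrelevant.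
\<close>

definition compose_oper :: "'a set \<Rightarrow> nat \<Rightarrow> 'a oper \<Rightarrow> (nat \<Rightarrow> 'a oper) \<Rightarrow> 'a oper" where
  "compose_oper D m f g =
     (m, \<lambda>x\<in>tuples D m. app f (\<lambda>i\<in>{..<arity f}. app (g i) x))"

definition function_clone :: "'a set \<Rightarrow> 'a oper set \<Rightarrow> bool" where
  "function_clone D \<D> \<longleftrightarrow>
     \<D> \<subseteq> operations D \<and>
     (\<forall>n\<ge>1. \<forall>k<n. projection D n k \<in> \<D>) \<and>
     (\<forall>f\<in>\<D>. \<forall>m\<ge>1. \<forall>g. (\<forall>i<arity f. g i \<in> \<D> \<and> arity (g i) = m) \<longrightarrow>
        compose_oper D m f g \<in> \<D>)"

text \<open>
  The sets of all \<open>n\<close>-ary operations are included in the subbasis. They are unions of the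
  remaining subbasic sets unless \<open>D\<close> is empty, in which case there are no remaining ones.
\<close>

definition oper_topology :: "'a set \<Rightarrow> 'a oper topology" where
  "oper_topology D = topology_generated_by
     ({nary_operations D n | n. n \<ge> 1} \<union>
      {{f \<in> nary_operations D n. app f a = b} | n a b. n \<ge> 1 \<and> a \<in> tuples D n \<and> b \<in> D})"

abbreviation clone_topology :: "'a set \<Rightarrow> 'a oper set \<Rightarrow> 'a oper topology" where
  "clone_topology D \<D> \<equiv> subtopology (oper_topology D) \<D>"

definition closed_function_clone :: "'a set \<Rightarrow> 'a oper set \<Rightarrow> bool" where
  "closed_function_clone D \<D> \<longleftrightarrow> function_clone D \<D> \<and> closedin (oper_topology D) \<D>"

definition clone_hom ::
  "'a set \<Rightarrow> 'a oper set \<Rightarrow> 'b set \<Rightarrow> 'b oper set \<Rightarrow> ('a oper \<Rightarrow> 'b oper) \<Rightarrow> bool" where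
  "clone_hom C \<C> D \<D> \<xi> \<longleftrightarrow>
     \<xi> \<in> \<C> \<rightarrow> \<D> \<and>
     (\<forall>f\<in>\<C>. arity (\<xi> f) = arity f) \<and>
     (\<forall>n\<ge>1. \<forall>k<n. \<xi> (projection C n k) = projection D n k) \<and>
     (\<forall>f\<in>\<C>. \<forall>m\<ge>1. \<forall>g. (\<forall>i<arity f. g i \<in> \<C> \<and> arity (g i) = m) \<longrightarrow>
        \<xi> (compose_oper C m f g) = compose_oper D m (\<xi> f) (\<lambda>i. \<xi> (g i)))"

definition clone_iso ::
  "'a set \<Rightarrow> 'a oper set \<Rightarrow> 'b set \<Rightarrow> 'b oper set \<Rightarrow> ('a oper \<Rightarrow> 'b oper) \<Rightarrow> bool" where
  "clone_iso C \<C> D \<D> \<xi> \<longleftrightarrow> clone_hom C \<C> D \<D> \<xi> \<and> bij_betw \<xi> \<C> \<D>"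

lemma openin_nary_operations:
  "n \<ge> 1 \<Longrightarrow> openin (oper_topology D) (nary_operations D n)"
  unfolding oper_topology_def by (rule topology_generated_by_Basis) auto

lemma topspace_oper_topology: "topspace (oper_topology D) = operations D"
  unfolding oper_topology_def topology_generated_by_topspace operations_def by auto

lemma closedin_nary_operations:
  assumes "n \<ge> 1"
  shows "closedin (oper_topology D) (nary_operations D n)"
proof -
  have "operations D - nary_operations D n = (\<Union>m\<in>{1..} - {n}. nary_operations D m)"
    by (auto simp: operations_def nary_operations_def)
  moreover have "openin (oper_topology D) (\<Union>m\<in>{1..} - {n}. nary_operations D m)"
    by (intro openin_Union) (auto intro: openin_nary_operations)
  moreover have "nary_operations D n \<subseteq> operations D"
    using assms by (auto simp: operations_def)
  ultimately show ?thesis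
    by (simp add: closedin_def topspace_oper_topology)
qed

lemma function_clone_operations: "function_clone D (operations D)"
proof -
  have "projection D n k \<in> operations D" if "n \<ge> 1" "k < n" for n k
    using that by (auto simp: operations_def nary_operations_def projection_def tuples_def)
  moreover have "compose_oper D m f g \<in> operations D"
    if "f \<in> operations D" "m \<ge> 1" "\<forall>i<arity f. g i \<in> operations D \<and> arity (g i) = m" for f m g
  proof -
    have "(\<lambda>i\<in>{..<arity f}. app (g i) x) \<in> tuples D (arity f)" if "x \<in> tuples D m" for x
      using that \<open>\<forall>i<arity f. g i \<in> operations D \<and> arity (g i) = m\<close>
      by (fastforce simp: operations_def nary_operations_def tuples_def PiE_iff)
    moreover have "app f \<in> tuples D (arity f) \<rightarrow>\<^sub>E D"
      using \<open>f \<in> operations D\<close> by (auto simp: operations_def nary_operations_def)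
    ultimately show ?thesis
      using \<open>m \<ge> 1\<close> by (auto simp: operations_def nary_operations_def compose_oper_def)
  qed
  ultimately show ?thesis
    by (simp add: function_clone_def)
qed

end

theory Submission imports Defs begin

text \<open>
  An open subset of \<open>\<C>\<close> is built from the conditions \<open>f a = b\<close>. Since \<open>\<C>\<close> contains the
  constants, such a condition is an equation inside the clone: composing \<open>f\<close> with the unary
  constants \<open>a\<^sub>i\<close> gives the unary constant \<open>b\<close> (lemma \<open>compose_constants_eq_constant_iff\<close>).
  An isomorphism preserves and reflects equations of this kind.

  Being constant is itself an equational property: a unary \<open>c\<close> is constant if and only if \<open>c(x)\<close>
  and \<open>c(y)\<close> agree as binary operations. Hence \<open>\<xi>\<close> sends the constant with value \<open>c\<close> to an
  operation of \<open>\<D>\<close> with a single value \<open>c'\<close> (lemma \<open>clone_hom_constant\<close>), provided that \<open>D\<close>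
  has an element. The equation in the clone, transported by \<open>\<xi>\<close>, therefore says
  \<open>(\<xi> f) a' = b'\<close>, which is again a condition at a single point and so defines an open subset
  of \<open>\<D>\<close> (lemma \<open>clone_iso_value_iff\<close>). This makes the inverse of \<open>\<xi>\<close> continuous. Over an empty
  \<open>D\<close> there is only one operation of each arity, and the topology is discrete.
\<close>

lemma function_clone_app:
  assumes "function_clone D \<D>" "f \<in> \<D>"
  shows "app f \<in> tuples D (arity f) \<rightarrow>\<^sub>E D"
  using assms by (auto simp: function_clone_def operations_def nary_operations_def)

lemma function_clone_nary_iff:
  assumes "function_clone D \<D>" "f \<in> \<D>"
  shows "f \<in> nary_operations D n \<longleftrightarrow> arity f = n"
  using function_clone_app[OF assms] unfolding nary_operations_def by blast

lemma restrict_eq_iff: "restrict f A = restrict g A \<longleftrightarrow> (\<forall>x\<in>A. f x = g x)"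
  by (metis restrict_apply' restrict_ext)

lemma topspace_clone_topology:
  "function_clone D \<D> \<Longrightarrow> topspace (clone_topology D \<D>) = \<D>"
  by (auto simp: topspace_oper_topology function_clone_def)

lemma function_clone_compose:
  assumes "function_clone D \<D>" "f \<in> \<D>" "m \<ge> 1"
    and "\<And>i. i < arity f \<Longrightarrow> g i \<in> \<D> \<and> arity (g i) = m"
  shows "compose_oper D m f g \<in> \<D>"
  using assms unfolding function_clone_def by blast

lemma clone_hom_compose:
  assumes "clone_hom C \<C> D \<D> \<xi>" "f \<in> \<C>" "m \<ge> 1"
    and "\<And>i. i < arity f \<Longrightarrow> g i \<in> \<C> \<and> arity (g i) = m"
  shows "\<xi> (compose_oper C m f g) = compose_oper D m (\<xi> f) (\<lambda>i. \<xi> (g i))"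
  using assms unfolding clone_hom_def by blast

text \<open>
  Arities are at least 1, so no tuples exist over the empty domain; the open set of all
  operations of a fixed arity then has only one element.
\<close>

lemma openin_oper_topology_empty:
  assumes "S \<subseteq> operations {}"
  shows "openin (oper_topology {}) S"
proof -
  have "openin (oper_topology {}) {f}" if "f \<in> S" for f :: "'a oper"
  proof -
    have f: "f \<in> nary_operations {} (arity f)" "arity f \<ge> 1"
      using assms that by (auto simp: operations_def nary_operations_def)
    then have "tuples ({} :: 'a set) (arity f) = {}"
      by (auto simp: tuples_def PiE_eq_empty_iff intro: exI[of _ 0])
    with f(1) have "nary_operations {} (arity f) = {f}"
      by (auto simp: nary_operations_def prod_eq_iff)
    then show ?thesis
      using openin_nary_operations[OF f(2), of "{} :: 'a set"] by simp
  qed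
  then have "openin (oper_topology {}) (\<Union>f\<in>S. {f})"
    by blast
  then show ?thesis by simp
qed

lemma compose_constants_eq_constant_iff:
  assumes "app f \<in> tuples C (arity f) \<rightarrow>\<^sub>E C" "a \<in> tuples C (arity f)" "b \<in> C"
  shows "compose_oper C 1 f (\<lambda>i. constant_oper C 1 (a i)) = constant_oper C 1 b \<longleftrightarrow> app f a = b"
proof -
  have a: "(\<lambda>i\<in>{..<arity f}. a i) = a"
    using assms(2) by (auto simp: tuples_def PiE_restrict)
  have inner: "(\<lambda>i\<in>{..<arity f}. app (constant_oper C 1 (a i)) x) = a" if "x \<in> tuples C 1" for x
    using that a by (simp add: constant_oper_def)
  have "compose_oper C 1 f (\<lambda>i. constant_oper C 1 (a i)) = (1, \<lambda>x\<in>tuples C 1. app f a)"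
    unfolding compose_oper_def using inner by (simp add: restrict_eq_iff)
  moreover have "(\<lambda>i\<in>{..<1}. b) \<in> tuples C 1"
    using assms(3) by (auto simp: tuples_def)
  ultimately show ?thesis
    by (auto simp: constant_oper_def restrict_eq_iff)
qed

text \<open>
  Constancy is expressed by the identity \<open>c(\<pi>\<^sub>0) = c(\<pi>\<^sub>1)\<close> for the two binary projections, and
  homomorphisms preserve identities.
\<close>

lemma clone_hom_constant:
  fixes \<xi> :: "'a oper \<Rightarrow> 'b oper"
  assumes hom: "clone_hom C \<C> D \<D> \<xi>" and C: "function_clone C \<C>"
    and c: "constant_oper C 1 c \<in> \<C>"
    and x: "x \<in> tuples D 1" and y: "y \<in> tuples D 1"
  shows "app (\<xi> (constant_oper C 1 c)) x = app (\<xi> (constant_oper C 1 c)) y"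
proof -
  let ?c = "constant_oper C 1 c"
  have arity: "arity (\<xi> ?c) = 1"
    using hom c by (auto simp: clone_hom_def constant_oper_def)
  have image: "\<xi> (compose_oper C 2 ?c (\<lambda>i. projection C 2 k))
      = compose_oper D 2 (\<xi> ?c) (\<lambda>i. projection D 2 k)" if "k < 2" for k
  proof -
    have "projection C 2 k \<in> \<C>"
      using C that by (simp add: function_clone_def)
    moreover have "\<xi> (projection C 2 k) = projection D 2 k"
      using hom that by (simp add: clone_hom_def)
    ultimately show ?thesis
      using clone_hom_compose[OF hom c, of 2 "\<lambda>i. projection C 2 k"]
      by (simp add: projection_def)
  qed
  have collapse: "compose_oper C 2 ?c (\<lambda>i. projection C 2 k) = constant_oper C 2 c" if "k < 2" for k
  proof -
    have "app ?c (\<lambda>i\<in>{..<1}. app (projection C 2 k) z) = c" if z: "z \<in> tuples C 2" for z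
    proof -
      have "z k \<in> C"
        using z \<open>k < 2\<close> by (auto simp: tuples_def)
      then have "(\<lambda>i\<in>{..<1}. app (projection C 2 k) z) \<in> tuples C 1"
        using z by (auto simp: tuples_def projection_def)
      then show ?thesis
        by (simp add: constant_oper_def)
    qed
    moreover have "arity ?c = 1"
      by (simp add: constant_oper_def)
    ultimately show ?thesis
      unfolding compose_oper_def by (simp add: constant_oper_def[of C 2] restrict_eq_iff)
  qed
  have eq: "compose_oper D 2 (\<xi> ?c) (\<lambda>i. projection D 2 0)
      = compose_oper D 2 (\<xi> ?c) (\<lambda>i. projection D 2 1)"
    using image[of 0] image[of 1] collapse[of 0] collapse[of 1] by simp
  \<comment> \<open>evaluating both sides at \<open>(x, y)\<close> gives the two values to be compared\<close>
  define z :: "nat \<Rightarrow> 'b" where "z = (\<lambda>i\<in>{..<2}. if i = 0 then x 0 else y 0)"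
  have "x 0 \<in> D" "y 0 \<in> D"
    using x y by (auto simp: tuples_def)
  then have z: "z \<in> tuples D 2"
    by (simp add: z_def tuples_def)
  have singleton: "(\<lambda>i\<in>{..<1}. u 0) = u" if "u \<in> tuples D 1" for u :: "nat \<Rightarrow> 'b"
    using that by (intro extensionalityI[of _ "{..<1}"]) (auto simp: tuples_def PiE_iff)
  have "(\<lambda>i\<in>{..<1}. app (projection D 2 0) z) = x"
    "(\<lambda>i\<in>{..<1}. app (projection D 2 1) z) = y"
    using singleton[OF x] singleton[OF y] z by (simp_all add: projection_def z_def)
  with fun_cong[OF arg_cong[OF eq, of app], of z] z arity show ?thesis
    by (simp add: compose_oper_def del: One_nat_def)
qed

text \<open>
  By \<open>compose_constants_eq_constant_iff\<close> the right-hand side is an equation between composites in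
  \<open>\<C>\<close>; injectivity of \<open>\<xi>\<close> is what lets it be reflected as well as preserved. The element \<open>d c\<close>
  is the single value of the image of the unary constant \<open>c\<close>, read off at an arbitrary point \<open>e\<close>
  of \<open>D\<close>.
\<close>

lemma clone_iso_value_iff:
  fixes \<xi> :: "'a oper \<Rightarrow> 'b oper"
  assumes iso: "clone_iso C \<C> D \<D> \<xi>"
    and C: "function_clone C \<C>" and D: "function_clone D \<D>"
    and const: "\<And>c. c \<in> C \<Longrightarrow> constant_oper C 1 c \<in> \<C>"
    and e: "e \<in> D"
    and f: "f \<in> \<C>" and a: "a \<in> tuples C (arity f)" and b: "b \<in> C"
  defines "d \<equiv> \<lambda>c. app (\<xi> (constant_oper C 1 c)) (\<lambda>i\<in>{..<1}. e)"
  shows "app (\<xi> f) (\<lambda>i\<in>{..<arity f}. d (a i)) = d b \<longleftrightarrow> app f a = b"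
proof -
  let ?k = "constant_oper C 1"
  have hom: "clone_hom C \<C> D \<D> \<xi>" and inj: "inj_on \<xi> \<C>"
    using iso by (auto simp: clone_iso_def bij_betw_def)
  have e1: "(\<lambda>i\<in>{..<1}. e) \<in> tuples D 1"
    using e by (auto simp: tuples_def)
  have arity_f: "arity (\<xi> f) = arity f"
    using hom f by (simp add: clone_hom_def)
  have aC: "a i \<in> C" if "i < arity f" for i
    using a that by (auto simp: tuples_def)
  have constants: "?k (a i) \<in> \<C> \<and> arity (?k (a i)) = 1" if "i < arity f" for i
    using const[OF aC[OF that]] by (simp add: constant_oper_def)
  have vals: "app (\<xi> (?k c)) x = d c" if "c \<in> C" "x \<in> tuples D 1" for c x
    unfolding d_def using clone_hom_constant[OF hom C const[OF that(1)] that(2) e1] .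
  have image: "\<xi> (?k b) = (1, \<lambda>x\<in>tuples D 1. d b)"
  proof (rule prod_eqI)
    have "\<xi> (?k b) \<in> \<D>" and ar: "arity (\<xi> (?k b)) = 1"
      using hom const[OF b] by (auto simp: clone_hom_def constant_oper_def)
    then have "app (\<xi> (?k b)) \<in> tuples D 1 \<rightarrow>\<^sub>E D"
      using function_clone_app[OF D] by metis
    then show "app (\<xi> (?k b)) = app (1, \<lambda>x\<in>tuples D 1. d b)"
      using vals[OF b] by (auto simp: fun_eq_iff PiE_iff extensional_def)
    show "arity (\<xi> (?k b)) = arity (1, \<lambda>x\<in>tuples D 1. d b)"
      using ar by simp
  qed
  have args: "(\<lambda>i\<in>{..<arity f}. app (\<xi> (?k (a i))) x) = (\<lambda>i\<in>{..<arity f}. d (a i))"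
    if "x \<in> tuples D 1" for x
    using vals[OF aC that] by (auto simp: fun_eq_iff)
  have "app f a = b \<longleftrightarrow> compose_oper C 1 f (\<lambda>i. ?k (a i)) = ?k b"
    using compose_constants_eq_constant_iff[OF function_clone_app[OF C f] a b] by simp
  also have "\<dots> \<longleftrightarrow> \<xi> (compose_oper C 1 f (\<lambda>i. ?k (a i))) = \<xi> (?k b)"
    using inj_on_eq_iff[OF inj function_clone_compose[OF C f _ constants] const[OF b]] by simp
  also have "\<dots> \<longleftrightarrow> compose_oper D 1 (\<xi> f) (\<lambda>i. \<xi> (?k (a i))) = \<xi> (?k b)"
    using clone_hom_compose[OF hom f _ constants] by simp
  also have "\<dots> \<longleftrightarrow> (\<forall>x\<in>tuples D 1. app (\<xi> f) (\<lambda>i\<in>{..<arity f}. d (a i)) = d b)"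
    by (simp add: compose_oper_def image arity_f args restrict_eq_iff del: One_nat_def)
  also have "\<dots> \<longleftrightarrow> app (\<xi> f) (\<lambda>i\<in>{..<arity f}. d (a i)) = d b"
    using e1 by blast
  finally show ?thesis by simp
qed

lemma continuous_map_inv_clone_iso:
  fixes \<xi> :: "'a oper \<Rightarrow> 'b oper"
  assumes iso: "clone_iso C \<C> D \<D> \<xi>"
    and C: "function_clone C \<C>" and D: "function_clone D \<D>"
    and const: "\<And>c. c \<in> C \<Longrightarrow> constant_oper C 1 c \<in> \<C>"
  shows "continuous_map (clone_topology D \<D>) (oper_topology C) (inv_into \<C> \<xi>)"
proof -
  let ?inv = "inv_into \<C> \<xi>" and ?T = "clone_topology D \<D>"
  have bij: "bij_betw \<xi> \<C> \<D>" and hom: "clone_hom C \<C> D \<D> \<xi>"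
    using iso by (auto simp: clone_iso_def)
  have inv: "?inv g \<in> \<C>" "\<xi> (?inv g) = g" if "g \<in> \<D>" for g
    using bij that by (auto simp: bij_betw_def inv_into_into f_inv_into_f)
  have arity: "arity (?inv g) = arity g" if "g \<in> \<D>" for g
  proof -
    have "arity (\<xi> (?inv g)) = arity (?inv g)"
      using hom inv(1)[OF that] by (simp add: clone_hom_def)
    then show ?thesis
      using inv(2)[OF that] by simp
  qed
  have top: "topspace ?T = \<D>"
    using D by (rule topspace_clone_topology)
  have oper: "app g \<in> tuples D (arity g) \<rightarrow>\<^sub>E D" if "g \<in> \<D>" for g
    using D that by (rule function_clone_app)
  note nary_iff = function_clone_nary_iff[OF D]
  have inv_nary: "?inv g \<in> nary_operations C n \<longleftrightarrow> g \<in> nary_operations D n" if "g \<in> \<D>" for g n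
    using function_clone_nary_iff[OF C inv(1)[OF that]] nary_iff[OF that] arity[OF that] by simp
  have nary: "openin ?T (?inv -` nary_operations C n \<inter> topspace ?T)" if "n \<ge> 1" for n
  proof -
    have "?inv -` nary_operations C n \<inter> topspace ?T = nary_operations D n \<inter> \<D>"
      unfolding top vimage_def using inv_nary by blast
    then show ?thesis
      using openin_subtopology_Int[OF openin_nary_operations[OF that]] by simp
  qed
  have val: "openin ?T (?inv -` {f \<in> nary_operations C n. app f a = b} \<inter> topspace ?T)"
    if n: "n \<ge> 1" and a: "a \<in> tuples C n" and b: "b \<in> C" for n a b
  proof (cases "D = {}")
    case True
    \<comment> \<open>no single-value conditions exist over \<open>D\<close>; discreteness replaces them\<close>
    let ?P = "?inv -` {f \<in> nary_operations C n. app f a = b} \<inter> topspace ?T"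
    have "?P \<subseteq> operations {}"
      using True D unfolding top function_clone_def by blast
    then have "openin (oper_topology D) ?P"
      unfolding True by (rule openin_oper_topology_empty)
    then have "openin ?T (?P \<inter> \<D>)"
      by (rule openin_subtopology_Int)
    moreover have "?P \<inter> \<D> = ?P"
      unfolding top by blast
    ultimately show ?thesis by simp
  next
    case False
    then obtain e where e: "e \<in> D" by blast
    define d where "d c = app (\<xi> (constant_oper C 1 c)) (\<lambda>i\<in>{..<1}. e)" for c
    define a' where "a' = (\<lambda>i\<in>{..<n}. d (a i))"
    have d: "d c \<in> D" if "c \<in> C" for c
    proof -
      have "\<xi> (constant_oper C 1 c) \<in> \<D>" "arity (\<xi> (constant_oper C 1 c)) = 1"
        using hom const[OF that] by (auto simp: clone_hom_def constant_oper_def)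
      then have "app (\<xi> (constant_oper C 1 c)) \<in> tuples D 1 \<rightarrow>\<^sub>E D"
        using oper by metis
      moreover have "(\<lambda>i\<in>{..<1}. e) \<in> tuples D 1"
        using e by (auto simp: tuples_def)
      ultimately show ?thesis
        unfolding d_def by blast
    qed
    have a': "a' \<in> tuples D n"
      using a d by (auto simp: a'_def tuples_def)
    have "app g a' = d b \<longleftrightarrow> app (?inv g) a = b" if "g \<in> \<D>" "arity g = n" for g
      using clone_iso_value_iff[OF iso C D const e inv(1)[OF that(1)], of a b]
        that inv(2) arity a b by (simp add: d_def a'_def)
    then have "?inv -` {f \<in> nary_operations C n. app f a = b} \<inter> topspace ?T
        = {g \<in> nary_operations D n. app g a' = d b} \<inter> \<D>"
      unfolding top vimage_def using inv_nary nary_iff by blast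
    moreover have "openin (oper_topology D) {g \<in> nary_operations D n. app g a' = d b}"
      unfolding oper_topology_def using n a' d[OF b]
      by (intro topology_generated_by_Basis) blast
    ultimately show ?thesis
      by (simp add: openin_subtopology_Int)
  qed
  have "?inv ` topspace ?T \<subseteq> operations C"
    unfolding top using inv(1) C by (auto simp: function_clone_def)
  then have "?inv ` topspace ?T \<subseteq> \<Union> ({nary_operations C n | n. n \<ge> 1} \<union>
      {{f \<in> nary_operations C n. app f a = b} | n a b. n \<ge> 1 \<and> a \<in> tuples C n \<and> b \<in> C})"
    unfolding operations_def by blast
  moreover have "openin ?T (?inv -` U \<inter> topspace ?T)"
    if "U \<in> {nary_operations C n | n. n \<ge> 1} \<union>
      {{f \<in> nary_operations C n. app f a = b} | n a b. n \<ge> 1 \<and> a \<in> tuples C n \<and> b \<in> C}" for U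
    using that nary val by blast
  ultimately show ?thesis
    unfolding oper_topology_def[of C] by (intro continuous_on_generated_topo)
qed

theorem proposition27:
  fixes C :: "'a set" and \<C> :: "'a oper set"
    and D :: "'b set" and \<D> :: "'b oper set"
    and \<xi> :: "'a oper \<Rightarrow> 'b oper"
  assumes "closed_function_clone C \<C>"
    and "\<forall>n\<ge>1. \<forall>c\<in>C. constant_oper C n c \<in> \<C>"
    and "function_clone D \<D>"
    and "clone_iso C \<C> D \<D> \<xi>"
  shows "\<forall>U. openin (clone_topology C \<C>) U \<longrightarrow> openin (clone_topology D \<D>) (\<xi> ` U)"
proof (intro allI impI)
  fix U
  assume "openin (clone_topology C \<C>) U"
  then obtain V where V: "openin (oper_topology C) V" "U = V \<inter> \<C>"
    by (auto simp: openin_subtopology)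
  have C: "function_clone C \<C>"
    using assms(1) by (simp add: closed_function_clone_def)
  have bij: "bij_betw \<xi> \<C> \<D>"
    using assms(4) by (simp add: clone_iso_def)
  have image: "\<xi> ` U = {g \<in> \<D>. inv_into \<C> \<xi> g \<in> V}"
    using bij V(2) by (force simp: bij_betw_def inv_into_f_f)
  have cont: "continuous_map (clone_topology D \<D>) (oper_topology C) (inv_into \<C> \<xi>)"
    using continuous_map_inv_clone_iso[OF assms(4) C assms(3)] assms(2) by simp
  have "openin (clone_topology D \<D>) {g \<in> \<D>. inv_into \<C> \<xi> g \<in> V}"
    using openin_continuous_map_preimage[OF cont V(1)]
    unfolding topspace_clone_topology[OF assms(3)] .
  with image show "openin (clone_topology D \<D>) (\<xi> ` U)" by simp
qed

end
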